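(* Let $\Gamma$ be a confusion graph on a finite source alphabet $\mathcal{X}$, let $\chi_f(\Gamma)$ be its fractional chromatic number, and let $\mathcal{L}$ be the (optimal) maximal leakage rate of the source coding problem $\Gamma$. Then $$\mathcal{L}=\log \chi_f(\Gamma).$$
   Context: Graphs are finite, simple and undirected. The confusion graph $\Gamma$ has vertex set $V(\Gamma)=\mathcal{X}$, the finite alphabet of a discrete memoryless stationary source $X$ (so $X^t=(X_1,\dots,X_t)$ has the product distribution $P_{X^t}(x^t)=\prod_{j}P_X(x_j)$). For a positive integer $t$, $\Gamma_t=\Gamma^{\lor t}$ is the graph on $\mathcal{X}^t$ (the $t$-fold OR product) in which $x^t$ and $v^t$ are adjacent iff $\{x_j,v_j\}$ is an edge of $\Gamma$ for some $j\in\{1,\dots,t\}$. $\mathcal{I}(G)$ denotes the set of independent sets of a graph $G$. A mapping scheme is a conditional distribution $P_{Y|X^t}$ from $\mathcal{X}^t$ to a finite code alphabet $\mathcal{Y}$ (which may be chosen freely). It is valid if for every $y\in\mathcal{Y}$ the set $\mathcal{X}^t(y)=\{x^t\in\mathcal{X}^t: P_{Y|X^t}(y|x^t)>0\}$ belongs to $\mathcal{I}(\Gamma_t)$. The maximal leakage of a valid mapping is $$L^t(P_{Y|X^t})=\log\max_{P_X}\frac{\sum_{y\in\mathcal{Y}}\max_{x^t\in\mathcal{X}^t}P_{X^t}(x^t)P_{Y|X^t}(y|x^t)}{\max_{x^t\in\mathcal{X}^t}P_{X^t}(x^t)}=\log\sum_{y\in\mathcal{Y}}\max_{x^t\in\mathcal{X}^t}P_{Y|X^t}(y|x^t),$$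 the maximum being over all probability distributions $P_X$ on $\mathcal{X}$. Put $\mathcal{L}^t=\inf L^t(P_{Y|X^t})$ over all valid mappings $P_{Y|X^t}$, and $\mathcal{L}=\lim_{t\to\infty}\frac1t\mathcal{L}^t$. The fractional chromatic number is $\chi_f(G)=\inf_b \chi_b(G)/b$, where $\chi_b(G)$ is the least $m$ for which there is a multiset $\{T_1,\dots,T_m\}$ of independent sets of $G$ such that every vertex lies in exactly $b$ of them (counted with multiplicity). The logarithm has a fixed base greater than 1. *)

theory Defs
  imports "HOL-Probability.Probability" "HOL-Library.Ramsey"
begin

text \<open>A graph is given by its vertex set and its set of edges, an edge being a two-element
  set of vertices.\<close>

definition simple_graph :: "'a set \<Rightarrow> 'a set set \<Rightarrow> bool" where
  "simple_graph V E \<longleftrightarrow> finite V \<and> E \<subseteq> nsets V 2"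

definition independent_sets :: "'a set \<Rightarrow> 'a set set \<Rightarrow> 'a set set" where
  "independent_sets V E = {S. S \<subseteq> V \<and> (\<forall>u\<in>S. \<forall>v\<in>S. {u, v} \<notin> E)}"

definition multi_chromatic_number :: "'a set \<Rightarrow> 'a set set \<Rightarrow> nat \<Rightarrow> nat" where
  "multi_chromatic_number V E b =
     (LEAST m. \<exists>M :: 'a set multiset. size M = m \<and> set_mset M \<subseteq> independent_sets V E \<and>
        (\<forall>v\<in>V. size {#T \<in># M. v \<in> T#} = b))"

definition fractional_chromatic_number :: "'a set \<Rightarrow> 'a set set \<Rightarrow> real" where
  "fractional_chromatic_number V E =
     (INF b\<in>{1..}. real (multi_chromatic_number V E b) / real b)"

definition words :: "'a set \<Rightarrow> nat \<Rightarrow> 'a list set" where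
  "words V t = {xs. set xs \<subseteq> V \<and> length xs = t}"

definition or_power_edges :: "'a set \<Rightarrow> 'a set set \<Rightarrow> nat \<Rightarrow> 'a list set set" where
  "or_power_edges V E t =
     {{xs, vs} | xs vs. xs \<in> words V t \<and> vs \<in> words V t \<and> (\<exists>j<t. {xs ! j, vs ! j} \<in> E)}"

definition source_prob :: "'a pmf \<Rightarrow> 'a list \<Rightarrow> real" where
  "source_prob p xs = (\<Prod>j<length xs. pmf p (xs ! j))"

text \<open>The conditional distribution of the code symbol given the source word \<open>xs\<close> is \<open>W xs\<close>.
  Finite subsets of \<^typ>\<open>nat\<close> serve as code alphabets, which covers every finite alphabet up to
  renaming. The values of \<open>W\<close> outside \<open>words V t\<close> are irrelevant.\<close>

definition valid_mapping ::
  "'a set \<Rightarrow> 'a set set \<Rightarrow> nat \<Rightarrow> nat set \<Rightarrow> ('a list \<Rightarrow> nat pmf) \<Rightarrow> bool" where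
  "valid_mapping V E t Y W \<longleftrightarrow>
     finite Y \<and> (\<forall>xs\<in>words V t. set_pmf (W xs) \<subseteq> Y) \<and>
     (\<forall>y\<in>Y. {xs \<in> words V t. pmf (W xs) y > 0} \<in> independent_sets (words V t) (or_power_edges V E t))"

text \<open>The supremum over the source distributions is a maximum, see \<open>leakage_ratio_le\<close> and
  \<open>leakage_ratio_uniform\<close> below.\<close>

definition leakage_ratio :: "'a set \<Rightarrow> nat \<Rightarrow> nat set \<Rightarrow> ('a list \<Rightarrow> nat pmf) \<Rightarrow> 'a pmf \<Rightarrow> real" where
  "leakage_ratio V t Y W p =
     (\<Sum>y\<in>Y. MAX xs\<in>words V t. source_prob p xs * pmf (W xs) y) /
     (MAX xs\<in>words V t. source_prob p xs)"

definition maximal_leakage :: "real \<Rightarrow> 'a set \<Rightarrow> nat \<Rightarrow> nat set \<Rightarrow> ('a list \<Rightarrow> nat pmf) \<Rightarrow> real" where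
  "maximal_leakage c V t Y W = log c (SUP p\<in>{p. set_pmf p \<subseteq> V}. leakage_ratio V t Y W p)"

definition optimal_leakage :: "real \<Rightarrow> 'a set \<Rightarrow> 'a set set \<Rightarrow> nat \<Rightarrow> real" where
  "optimal_leakage c V E t = (INF (Y, W)\<in>{(Y, W). valid_mapping V E t Y W}. maximal_leakage c V t Y W)"

definition leakage_rate :: "real \<Rightarrow> 'a set \<Rightarrow> 'a set set \<Rightarrow> real" where
  "leakage_rate c V E = lim (\<lambda>t. optimal_leakage c V E t / real t)"


lemma finite_words: "finite V \<Longrightarrow> finite (words V t)"
  by (simp add: words_def finite_lists_length_eq)

lemma words_nonempty:
  assumes "V \<noteq> {}"
  shows "words V t \<noteq> {}"
proof -
  obtain a where "a \<in> V" using assms by auto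
  then have "replicate t a \<in> words V t" by (auto simp: words_def)
  then show ?thesis by auto
qed

lemma source_prob_nonneg: "source_prob p xs \<ge> 0"
  by (simp add: source_prob_def prod_nonneg)

lemma Max_source_prob_pos:
  assumes "finite V" "set_pmf p \<subseteq> V"
  shows "(MAX xs\<in>words V t. source_prob p xs) > 0"
proof -
  obtain a where a: "a \<in> set_pmf p" using set_pmf_not_empty[of p] by auto
  then have "replicate t a \<in> words V t" using assms by (auto simp: words_def)
  then have "source_prob p (replicate t a) \<le> (MAX xs\<in>words V t. source_prob p xs)"
    by (intro Max_ge) (auto simp: finite_words assms)
  moreover have "source_prob p (replicate t a) > 0"
    using a by (auto simp: source_prob_def pmf_positive intro!: prod_pos)
  ultimately show ?thesis by linarith
qed

lemma leakage_ratio_le: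
  assumes "finite V" "set_pmf p \<subseteq> V"
  shows "leakage_ratio V t Y W p \<le> (\<Sum>y\<in>Y. MAX xs\<in>words V t. pmf (W xs) y)"
proof -
  let ?M = "MAX xs\<in>words V t. source_prob p xs"
  have pos: "?M > 0" using Max_source_prob_pos[OF assms] .
  have ne: "words V t \<noteq> {}"
    using words_nonempty assms set_pmf_not_empty[of p] by (metis subset_empty)
  have fin: "finite (words V t)" using finite_words[OF assms(1)] .
  have le: "(MAX xs\<in>words V t. source_prob p xs * pmf (W xs) y)
      \<le> ?M * (MAX xs\<in>words V t. pmf (W xs) y)" for y
  proof (rule Max.boundedI)
    fix r assume "r \<in> (\<lambda>xs. source_prob p xs * pmf (W xs) y) ` words V t"
    then obtain xs where xs: "xs \<in> words V t" "r = source_prob p xs * pmf (W xs) y" by auto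
    show "r \<le> ?M * (MAX xs\<in>words V t. pmf (W xs) y)"
      unfolding xs(2) using xs(1) fin pos
      by (intro mult_mono) (auto simp: less_imp_le intro: Max_ge)
  qed (use fin ne in auto)
  have "(\<Sum>y\<in>Y. MAX xs\<in>words V t. source_prob p xs * pmf (W xs) y)
      \<le> ?M * (\<Sum>y\<in>Y. MAX xs\<in>words V t. pmf (W xs) y)"
    unfolding sum_distrib_left by (intro sum_mono le)
  then show ?thesis using pos by (simp add: leakage_ratio_def divide_le_eq mult.commute)
qed

lemma leakage_ratio_uniform:
  assumes "finite V" "V \<noteq> {}"
  shows "leakage_ratio V t Y W (pmf_of_set V) = (\<Sum>y\<in>Y. MAX xs\<in>words V t. pmf (W xs) y)"
proof -
  define q where "q = (1 / real (card V)) ^ t"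
  have q: "q > 0" using assms by (simp add: q_def card_gt_0_iff)
  have fin: "finite (words V t)" and ne: "words V t \<noteq> {}"
    using finite_words[OF assms(1)] words_nonempty[OF assms(2)] by auto
  have sp: "source_prob (pmf_of_set V) xs = q" if "xs \<in> words V t" for xs
  proof -
    have "pmf (pmf_of_set V) (xs ! j) = 1 / real (card V)" if "j < t" for j
    proof -
      have "xs ! j \<in> V" using \<open>xs \<in> words V t\<close> that nth_mem[of j xs] by (auto simp: words_def)
      then show ?thesis using assms by simp
    qed
    then show ?thesis using that by (simp add: source_prob_def words_def q_def)
  qed
  have "(MAX xs\<in>words V t. source_prob (pmf_of_set V) xs * pmf (W xs) y)
      = q * (MAX xs\<in>words V t. pmf (W xs) y)" for y
  proof -
    have "mono (\<lambda>r. q * r)" using q by (intro monoI) simp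
    then have "q * (MAX xs\<in>words V t. pmf (W xs) y)
        = Max ((\<lambda>r. q * r) ` (\<lambda>xs. pmf (W xs) y) ` words V t)"
      using fin ne by (intro mono_Max_commute) auto
    also have "\<dots> = (MAX xs\<in>words V t. source_prob (pmf_of_set V) xs * pmf (W xs) y)"
      by (simp add: image_image sp cong: image_cong_simp)
    finally show ?thesis by simp
  qed
  moreover have "(MAX xs\<in>words V t. source_prob (pmf_of_set V) xs) = q"
    using ne by (simp add: sp image_constant_conv cong: image_cong_simp)
  ultimately show ?thesis using q by (simp add: leakage_ratio_def flip: sum_distrib_left)
qed

lemma maximal_leakage_eq:
  assumes "finite V" "V \<noteq> {}"
  shows "maximal_leakage c V t Y W = log c (\<Sum>y\<in>Y. MAX xs\<in>words V t. pmf (W xs) y)"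
proof -
  have "(SUP p\<in>{p. set_pmf p \<subseteq> V}. leakage_ratio V t Y W p)
      = (\<Sum>y\<in>Y. MAX xs\<in>words V t. pmf (W xs) y)"
  proof (rule cSup_eq_maximum)
    show "(\<Sum>y\<in>Y. MAX xs\<in>words V t. pmf (W xs) y)
        \<in> leakage_ratio V t Y W ` {p. set_pmf p \<subseteq> V}"
      using leakage_ratio_uniform[OF assms, of t Y W] assms
      by (intro image_eqI[where x = "pmf_of_set V"]) auto
  qed (use leakage_ratio_le[OF assms(1)] in auto)
  then show ?thesis by (simp add: maximal_leakage_def)
qed

end

theory Submission
  imports Defs
begin

text \<open>For every \<open>t \<ge> 1\<close> the optimal leakage equals \<open>t * log c \<chi>\<^sub>f\<close>. A \<open>b\<close>-fold colouring by \<open>m\<close>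
  independent sets gives a valid mapping that encodes each letter by a uniformly chosen colour
  class containing it, and whose value is at most \<open>(m / b)^t\<close>. Conversely, the weights
  \<open>max\<^sub>x W(y|x)\<close> on the independent sets \<open>X(y)\<close> cover every word with weight at least 1. Fixing the
  first letter and inducting on \<open>t\<close> shows, without linear programming duality, that such a cover
  has total weight at least \<open>\<chi>\<^sub>f^t\<close>.\<close>

section \<open>Multiple colourings as indexed families\<close>

text \<open>Indices \<open>i < m\<close> stand for the members of the multiset in
  \<open>multi_chromatic_number\<close>, so that multiplicities become cardinalities of index
  sets.\<close>

definition fold_cover :: "'a set \<Rightarrow> 'a set set \<Rightarrow> nat \<Rightarrow> nat \<Rightarrow> (nat \<Rightarrow> 'a set) \<Rightarrow> bool" where
  "fold_cover V E b m T \<longleftrightarrow>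
     (\<forall>i<m. T i \<in> independent_sets V E) \<and> (\<forall>v\<in>V. card {i. i < m \<and> v \<in> T i} = b)"

lemma independent_sets_subset:
  "S \<in> independent_sets V E \<Longrightarrow> S' \<subseteq> S \<Longrightarrow> S' \<in> independent_sets V E"
  by (auto simp: independent_sets_def)

lemma multi_chromatic_number_fold_cover:
  "multi_chromatic_number V E b = (LEAST m. \<exists>T. fold_cover V E b m T)"
proof -
  have "(\<exists>M. size M = m \<and> set_mset M \<subseteq> independent_sets V E \<and>
        (\<forall>v\<in>V. size {#T \<in># M. v \<in> T#} = b)) \<longleftrightarrow> (\<exists>T. fold_cover V E b m T)" (is "?L \<longleftrightarrow> ?R") for m
  proof
    assume ?L
    then obtain M where M: "size M = m" "set_mset M \<subseteq> independent_sets V E"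
      "\<forall>v\<in>V. size {#T \<in># M. v \<in> T#} = b" by blast
    obtain l where l: "mset l = M" using ex_mset by blast
    have "size {#T \<in># M. v \<in> T#} = card {i. i < length l \<and> v \<in> l ! i}" for v
      unfolding l[symmetric] by (simp flip: mset_filter add: length_filter_conv_card)
    then have "fold_cover V E b m (\<lambda>i. l ! i)"
      using M l by (auto simp: fold_cover_def)
    then show ?R by blast
  next
    assume ?R
    then obtain T where T: "fold_cover V E b m T" by blast
    let ?l = "map T [0..<m]"
    have "size {#S \<in># mset ?l. v \<in> S#} = card {i. i < m \<and> v \<in> T i}" for v
      by (simp flip: mset_filter add: length_filter_conv_card del: mset_map cong: conj_cong)
    then show ?L
      using T by (intro exI[of _ "mset ?l"]) (auto simp: fold_cover_def)
  qed
  then show ?thesis by (simp add: multi_chromatic_number_def)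
qed

text \<open>Excess covering can be removed: for each vertex keep \<open>b\<close> of the indices
  that cover it and delete the vertex from the other sets, which stay independent as subsets of
  independent sets.\<close>

lemma fold_cover_trim:
  assumes "\<And>i. i < m \<Longrightarrow> T i \<in> independent_sets V E"
    and "\<And>v. v \<in> V \<Longrightarrow> b \<le> card {i. i < m \<and> v \<in> T i}"
  shows "\<exists>T'. fold_cover V E b m T'"
proof -
  have "\<forall>v\<in>V. \<exists>J. J \<subseteq> {i. i < m \<and> v \<in> T i} \<and> card J = b"
    using assms(2) by (meson obtain_subset_with_card_n)
  then obtain J where J: "\<And>v. v \<in> V \<Longrightarrow> J v \<subseteq> {i. i < m \<and> v \<in> T i} \<and> card (J v) = b"
    by metis
  have "{v \<in> V. i \<in> J v} \<subseteq> T i" for i using J by auto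
  moreover have "{i. i < m \<and> v \<in> {v \<in> V. i \<in> J v}} = J v" if "v \<in> V" for v
    using J[OF that] that by auto
  ultimately have "fold_cover V E b m (\<lambda>i. {v \<in> V. i \<in> J v})"
    using J assms(1) independent_sets_subset unfolding fold_cover_def
    by (metis (no_types, lifting))
  then show ?thesis by blast
qed

lemma multi_chromatic_number_le:
  assumes "finite I" "\<And>i. i \<in> I \<Longrightarrow> T i \<in> independent_sets V E"
    and "\<And>v. v \<in> V \<Longrightarrow> b \<le> card {i \<in> I. v \<in> T i}"
  shows "multi_chromatic_number V E b \<le> card I"
proof -
  obtain h where h: "bij_betw h {0..<card I} I"
    using ex_bij_betw_nat_finite[OF assms(1)] by blast
  have "card {i. i < card I \<and> v \<in> T (h i)} = card {i \<in> I. v \<in> T i}" for v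
  proof (rule bij_betw_same_card)
    have "h ` {i. i < card I \<and> v \<in> T (h i)} = {i \<in> I. v \<in> T i}"
      using bij_betw_imp_surj_on[OF h] by force
    then show "bij_betw h {i. i < card I \<and> v \<in> T (h i)} {i \<in> I. v \<in> T i}"
      using h by (auto simp: bij_betw_def inj_on_def)
  qed
  moreover have "T (h i) \<in> independent_sets V E" if "i < card I" for i
    using assms(2) bij_betwE[OF h] that by auto
  ultimately have "\<exists>T'. fold_cover V E b (card I) T'"
    using assms(3) by (intro fold_cover_trim[where T = "\<lambda>i. T (h i)"]) auto
  then show ?thesis
    unfolding multi_chromatic_number_fold_cover by (rule Least_le)
qed

context
  fixes V :: "'a set" and E :: "'a set set"
  assumes graph: "simple_graph V E"
begin

lemma finite_vertices: "finite V"
  using graph by (simp add: simple_graph_def)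

lemma singleton_independent: "v \<in> V \<Longrightarrow> {v} \<in> independent_sets V E"
  using graph by (auto simp: simple_graph_def independent_sets_def nsets_def)

text \<open>Take every singleton \<open>b\<close> times. This makes the \<open>LEAST\<close> in the
  chromatic number a value that is attained.\<close>

lemma fold_cover_exists: "\<exists>m T. fold_cover V E b m T"
proof -
  obtain n and f :: "nat \<Rightarrow> 'a \<times> nat" where f: "V \<times> {..<b} = f ` {i. i < n}" "inj_on f {i. i < n}"
    using finite_imp_nat_seg_image_inj_on[of "V \<times> {..<b}"] finite_vertices by auto
  have "card {i. i < n \<and> v \<in> {fst (f i)}} \<ge> b" if "v \<in> V" for v
  proof -
    have "{v} \<times> {..<b} \<subseteq> f ` {i. i < n \<and> v \<in> {fst (f i)}}"
    proof
      fix p assume p: "p \<in> {v} \<times> {..<b}"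
      then have "p \<in> f ` {i. i < n}" using f(1) that by blast
      then obtain i where "i < n" "p = f i" by blast
      moreover have "fst p = v" using p by auto
      ultimately show "p \<in> f ` {i. i < n \<and> v \<in> {fst (f i)}}" by blast
    qed
    then have "card ({v} \<times> {..<b}) \<le> card {i. i < n \<and> v \<in> {fst (f i)}}"
      by (rule surj_card_le[rotated]) simp
    then show ?thesis by (simp add: card_cartesian_product)
  qed
  moreover have "{fst (f i)} \<in> independent_sets V E" if "i < n" for i
  proof -
    have "f i \<in> V \<times> {..<b}" using f(1) that by blast
    then show ?thesis by (intro singleton_independent) auto
  qed
  ultimately show ?thesis using fold_cover_trim[of n "\<lambda>i. {fst (f i)}" V E b] by blast
qed

lemma multi_chromatic_number_attained: "\<exists>T. fold_cover V E b (multi_chromatic_number V E b) T"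
  unfolding multi_chromatic_number_fold_cover
  by (rule LeastI_ex) (use fold_cover_exists in blast)

section \<open>Bounds on the fractional chromatic number\<close>

lemma fractional_chromatic_number_le:
  "b \<ge> 1 \<Longrightarrow> fractional_chromatic_number V E \<le> real (multi_chromatic_number V E b) / real b"
  unfolding fractional_chromatic_number_def by (intro cINF_lower bdd_belowI2[of _ 0]) auto

text \<open>A single vertex already lies in sets with \<open>b\<close> different indices, so
  \<open>b \<le> m\<close>. Later this supplies the positivity that divisions and logarithms
  require.\<close>

lemma fractional_chromatic_number_ge_1:
  assumes "V \<noteq> {}"
  shows "fractional_chromatic_number V E \<ge> 1"
  unfolding fractional_chromatic_number_def
proof (rule cINF_greatest)
  fix b :: nat assume b: "b \<in> {1..}"
  obtain T where T: "fold_cover V E b (multi_chromatic_number V E b) T"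
    using multi_chromatic_number_attained by blast
  obtain v where "v \<in> V" using assms by blast
  then have "b = card {i. i < multi_chromatic_number V E b \<and> v \<in> T i}"
    using T by (auto simp: fold_cover_def)
  also have "\<dots> \<le> card {..<multi_chromatic_number V E b}"
    by (rule card_mono) auto
  finally show "1 \<le> real (multi_chromatic_number V E b) / real b"
    using b by simp
qed auto

text \<open>The definition only admits rational weights; real weights \<open>w\<close> are approximated by taking
  \<open>\<lceil>N * w i\<rceil>\<close> copies of each set and letting \<open>N\<close> tend to infinity.\<close>

lemma fractional_chromatic_number_le_cover:
  fixes w :: "'i \<Rightarrow> real"
  assumes I: "finite I" and w: "\<And>i. i \<in> I \<Longrightarrow> w i \<ge> 0"
    and T: "\<And>i. i \<in> I \<Longrightarrow> T i \<in> independent_sets V E"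
    and cov: "\<And>v. v \<in> V \<Longrightarrow> 1 \<le> (\<Sum>i\<in>{i\<in>I. v \<in> T i}. w i)"
  shows "fractional_chromatic_number V E \<le> (\<Sum>i\<in>I. w i)"
proof -
  have bound: "fractional_chromatic_number V E \<le> (\<Sum>i\<in>I. w i) + real (card I) / real N"
    if N: "N \<ge> 1" for N
  proof -
    define k where "k i = nat \<lceil>real N * w i\<rceil>" for i
    define K where "K = (SIGMA i:I. {..<k i})"
    have kge: "real N * w i \<le> real (k i)" for i
      unfolding k_def by (rule of_nat_ceiling)
    \<comment> \<open>Unlike \<open>kge\<close>, this needs \<open>w i \<ge> 0\<close>, since
      \<open>nat\<close> cuts negative values off at 0. The summand 1 produces the error
      \<open>card I / N\<close>.\<close>
    have kle: "real (k i) \<le> real N * w i + 1" if "i \<in> I" for i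
    proof -
      have "0 \<le> real N * w i" using w[OF that] by simp
      then show ?thesis unfolding k_def by linarith
    qed
    have "N \<le> card {p \<in> K. v \<in> T (fst p)}" if "v \<in> V" for v
    proof -
      have "{p \<in> K. v \<in> T (fst p)} = (SIGMA i:{i\<in>I. v \<in> T i}. {..<k i})"
        by (auto simp: K_def)
      then have card: "card {p \<in> K. v \<in> T (fst p)} = (\<Sum>i\<in>{i\<in>I. v \<in> T i}. k i)"
        using I by simp
      have "real N * 1 \<le> real N * (\<Sum>i\<in>{i\<in>I. v \<in> T i}. w i)"
        using cov[OF that] by (intro mult_left_mono) auto
      also have "\<dots> \<le> (\<Sum>i\<in>{i\<in>I. v \<in> T i}. real (k i))"
        unfolding sum_distrib_left by (intro sum_mono kge)
      finally have "real N \<le> real (\<Sum>i\<in>{i\<in>I. v \<in> T i}. k i)" by simp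
      then show ?thesis unfolding card by (simp only: of_nat_le_iff)
    qed
    moreover have "finite K" using I by (auto simp: K_def)
    ultimately have "multi_chromatic_number V E N \<le> card K"
      using T by (intro multi_chromatic_number_le[where T = "\<lambda>p. T (fst p)"]) (auto simp: K_def)
    then have "real (multi_chromatic_number V E N) \<le> (\<Sum>i\<in>I. real (k i))"
      using I by (simp add: K_def flip: of_nat_sum)
    also have "\<dots> \<le> (\<Sum>i\<in>I. real N * w i + 1)" by (intro sum_mono kle)
    also have "\<dots> = real N * (\<Sum>i\<in>I. w i) + real (card I)"
      by (simp add: sum.distrib sum_distrib_left)
    finally have "real (multi_chromatic_number V E N) / real N
        \<le> (\<Sum>i\<in>I. w i) + real (card I) / real N"
      using N by (simp add: field_simps)
    then show ?thesis using fractional_chromatic_number_le[OF N] by linarith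
  qed
  have "(\<lambda>N. (\<Sum>i\<in>I. w i) + real (card I) / real N) \<longlonglongrightarrow> (\<Sum>i\<in>I. w i) + 0"
    by (intro tendsto_intros lim_const_over_n)
  then have "(\<lambda>N. (\<Sum>i\<in>I. w i) + real (card I) / real N) \<longlonglongrightarrow> (\<Sum>i\<in>I. w i)" by simp
  then show ?thesis
    by (rule LIMSEQ_le_const) (use bound in blast)
qed

section \<open>Lower bound: covers of the word graph\<close>

text \<open>Independence in the OR power is a condition on each coordinate separately. Hence the
  first letters of an independent set, and its tails after a fixed first letter, are again
  independent.\<close>

lemma independent_or_power_iff:
  "S \<in> independent_sets (words V t) (or_power_edges V E t) \<longleftrightarrow>
     S \<subseteq> words V t \<and> (\<forall>xs\<in>S. \<forall>ys\<in>S. \<forall>j<t. {xs ! j, ys ! j} \<notin> E)"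
proof -
  have "{xs, ys} \<in> or_power_edges V E t \<longleftrightarrow> (\<exists>j<t. {xs ! j, ys ! j} \<in> E)"
    if "xs \<in> words V t" "ys \<in> words V t" for xs ys
    using that by (auto simp: or_power_edges_def doubleton_eq_iff insert_commute)
  then show ?thesis unfolding independent_sets_def by blast
qed

lemma word_cover_weight:
  fixes w :: "'i \<Rightarrow> real"
  assumes "V \<noteq> {}" "finite I" "\<And>i. i \<in> I \<Longrightarrow> w i \<ge> 0" "r > 0"
    and "\<And>i. i \<in> I \<Longrightarrow> S i \<in> independent_sets (words V t) (or_power_edges V E t)"
    and "\<And>xs. xs \<in> words V t \<Longrightarrow> r \<le> (\<Sum>i\<in>{i\<in>I. xs \<in> S i}. w i)"
  shows "r * fractional_chromatic_number V E ^ t \<le> (\<Sum>i\<in>I. w i)"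
  using assms(2-)
\<comment> \<open>The induction hypothesis is applied to a subfamily of \<open>I\<close> and to sets
  of tails, so \<open>I\<close> and \<open>S\<close> must vary.\<close>
proof (induction t arbitrary: I S)
  case 0
  have "r \<le> (\<Sum>i\<in>{i\<in>I. [] \<in> S i}. w i)" by (rule 0) (simp add: words_def)
  also have "\<dots> \<le> (\<Sum>i\<in>I. w i)" using 0 by (intro sum_mono2) auto
  finally show ?case by simp
next
  case (Suc t)
  let ?q = "fractional_chromatic_number V E"
  let ?r = "r * ?q ^ t"
  define A where "A i = {v. \<exists>xs. v # xs \<in> S i}" for i
  have ind: "S i \<subseteq> words V (Suc t)"
    "\<And>xs ys j. xs \<in> S i \<Longrightarrow> ys \<in> S i \<Longrightarrow> j < Suc t \<Longrightarrow> {xs ! j, ys ! j} \<notin> E" if "i \<in> I" for i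
    using Suc.prems(4)[OF that] by (auto simp: independent_or_power_iff)
  have A: "A i \<in> independent_sets V E" if "i \<in> I" for i
    using ind[OF that] ind(2)[OF that, of _ _ 0]
    by (fastforce simp: A_def independent_sets_def words_def)
  have "?r \<le> (\<Sum>i\<in>{i\<in>I. v \<in> A i}. w i)" if v: "v \<in> V" for v
  \<comment> \<open>Fix the first letter \<open>v\<close>. The tails after \<open>v\<close> of the
    sets that contain a word starting with \<open>v\<close> cover all words of length
    \<open>t\<close> with weight at least \<open>r\<close>.\<close>
  proof (rule Suc.IH[where S = "\<lambda>i. {xs. v # xs \<in> S i}"])
    fix i assume i: "i \<in> {i\<in>I. v \<in> A i}"
    have "{xs ! j, ys ! j} \<notin> E" if "v # xs \<in> S i" "v # ys \<in> S i" "j < t" for xs ys j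
      using ind(2)[of i "v # xs" "v # ys" "Suc j"] i that by simp
    moreover have "{xs. v # xs \<in> S i} \<subseteq> words V t"
      using ind(1)[of i] i by (fastforce simp: words_def)
    ultimately show "{xs. v # xs \<in> S i} \<in> independent_sets (words V t) (or_power_edges V E t)"
      by (simp add: independent_or_power_iff)
  next
    fix xs assume "xs \<in> words V t"
    then have "v # xs \<in> words V (Suc t)" using v by (auto simp: words_def)
    then have "r \<le> (\<Sum>i\<in>{i\<in>I. v # xs \<in> S i}. w i)" by (rule Suc.prems(5))
    \<comment> \<open>A set containing \<open>v # xs\<close> has \<open>v\<close> among its first
      letters, so restricting the index set loses no weight.\<close>
    also have "{i\<in>I. v # xs \<in> S i} = {i \<in> {i\<in>I. v \<in> A i}. xs \<in> {xs. v # xs \<in> S i}}"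
      by (auto simp: A_def)
    finally show "r \<le> (\<Sum>i\<in>{i \<in> {i\<in>I. v \<in> A i}. xs \<in> {xs. v # xs \<in> S i}}. w i)" .
  qed (use Suc.prems in auto)
  moreover have r: "?r > 0"
    using fractional_chromatic_number_ge_1[OF assms(1)] Suc.prems(3) by simp
  \<comment> \<open>Divided by \<open>?r\<close>, the weights make the sets \<open>A i\<close> of
    first letters a fractional cover of \<open>V\<close>.\<close>
  ultimately have "?q \<le> (\<Sum>i\<in>I. w i / ?r)"
    using Suc.prems A by (intro fractional_chromatic_number_le_cover[where T = A])
      (auto simp flip: sum_divide_distrib)
  then show ?case using r by (simp add: field_simps flip: sum_divide_distrib)
qed

lemma valid_mapping_lower_bound:
  assumes "V \<noteq> {}" "valid_mapping V E t Y W"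
  shows "fractional_chromatic_number V E ^ t \<le> (\<Sum>y\<in>Y. MAX xs\<in>words V t. pmf (W xs) y)"
proof -
  let ?M = "\<lambda>y. MAX xs\<in>words V t. pmf (W xs) y"
  have le: "pmf (W xs) y \<le> ?M y" if "xs \<in> words V t" for xs y
    using that finite_words[OF finite_vertices] by (intro Max_ge) auto
  have M0: "0 \<le> ?M y" for y
    using words_nonempty[OF assms(1), of t] le by (metis all_not_in_conv order_trans pmf_nonneg)
  have fin: "finite Y" using assms(2) by (simp add: valid_mapping_def)
  have "1 * fractional_chromatic_number V E ^ t \<le> (\<Sum>y\<in>Y. ?M y)"
  proof (rule word_cover_weight[where S = "\<lambda>y. {xs \<in> words V t. pmf (W xs) y > 0}"])
    fix xs assume xs: "xs \<in> words V t"
    \<comment> \<open>Only symbols whose independent set contains \<open>xs\<close> contribute to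
      its total probability 1, and each contributes at most its maximum over all words.\<close>
    then have "1 = (\<Sum>y\<in>Y. pmf (W xs) y)"
      using assms(2) by (intro sum_pmf_eq_1[symmetric]) (auto simp: valid_mapping_def)
    also have "\<dots> = (\<Sum>y\<in>{y\<in>Y. pmf (W xs) y > 0}. pmf (W xs) y)"
      using fin by (intro sum.mono_neutral_right) (auto simp: order_less_le)
    also have "\<dots> \<le> (\<Sum>y\<in>{y\<in>Y. pmf (W xs) y > 0}. ?M y)"
      using xs by (intro sum_mono le)
    finally show "1 \<le> (\<Sum>y\<in>{y\<in>Y. xs \<in> {xs \<in> words V t. pmf (W xs) y > 0}}. ?M y)"
      using xs by simp
  qed (use assms M0 fin in \<open>auto simp: valid_mapping_def\<close>)
  then show ?thesis by simp
qed

section \<open>Upper bound: a mapping from a colouring\<close>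

text \<open>A code symbol is a \<open>t\<close>-tuple of colours, turned into a natural number by
  the injection \<open>e\<close>. A word is sent uniformly to one of the \<open>b ^ t\<close> tuples
  in \<open>Q xs\<close>, whose colour classes contain its letters. There are \<open>m ^ t\<close>
  symbols, each with probability at most \<open>1 / b ^ t\<close>.\<close>

lemma valid_mapping_from_fold_cover:
  assumes T: "fold_cover V E b m T" and b: "b \<ge> 1" and "V \<noteq> {}"
  shows "\<exists>Y W. valid_mapping V E t Y W \<and>
    (\<Sum>y\<in>Y. MAX xs\<in>words V t. pmf (W xs) y) \<le> (real m / real b) ^ t"
proof -
  define P where "P = PiE {..<t} (\<lambda>_. {..<m})"
  define Q where "Q xs = PiE {..<t} (\<lambda>j. {i. i < m \<and> xs ! j \<in> T i})" for xs
  have finP: "finite P" by (simp add: P_def finite_PiE)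
  obtain e :: "(nat \<Rightarrow> nat) \<Rightarrow> nat" where e: "inj_on e P"
    using finite_imp_inj_to_nat_seg[OF finP] by blast
  define W where "W xs = pmf_of_set (e ` Q xs)" for xs
  have QP: "Q xs \<subseteq> P" for xs unfolding P_def Q_def by (rule PiE_mono) auto
  have Qfin: "finite (e ` Q xs)" for xs using finite_subset[OF QP finP] by blast
  have cardQ: "card (e ` Q xs) = b ^ t" if xs: "xs \<in> words V t" for xs
  proof -
    have "card (e ` Q xs) = card (Q xs)"
      using inj_on_subset[OF e QP] by (rule card_image)
    also have "\<dots> = (\<Prod>j<t. card {i. i < m \<and> xs ! j \<in> T i})"
      by (simp add: Q_def card_PiE)
    also have "\<dots> = (\<Prod>j<t. b)"
    proof (rule prod.cong)
      fix j assume "j \<in> {..<t}"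
      then have "xs ! j \<in> V" using xs nth_mem[of j xs] by (auto simp: words_def)
      then show "card {i. i < m \<and> xs ! j \<in> T i} = b" using T by (simp add: fold_cover_def)
    qed simp
    finally show ?thesis by simp
  qed
  have Qne: "e ` Q xs \<noteq> {}" if "xs \<in> words V t" for xs
    using cardQ[OF that] b by (metis card.empty not_one_le_zero power_eq_0_iff)
  have pmfW: "pmf (W xs) y = (if y \<in> e ` Q xs then 1 / real b ^ t else 0)"
    if "xs \<in> words V t" for xs y
    using Qne[OF that] Qfin cardQ[OF that] by (simp add: W_def indicator_def)
  then have pmf_le: "pmf (W xs) y \<le> 1 / real b ^ t" if "xs \<in> words V t" for xs y
    using that by simp
  have "{xs \<in> words V t. pmf (W xs) y > 0} \<in> independent_sets (words V t) (or_power_edges V E t)"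
    if y: "y \<in> e ` P" for y
  proof -
    obtain p where p: "p \<in> P" "y = e p" using y by blast
    \<comment> \<open>Words that share the symbol of \<open>p\<close> have their \<open>j\<close>-th
      letters in the same independent set \<open>T (p j)\<close>, so no coordinate separates
      them.\<close>
    have *: "xs ! j \<in> T (p j)" if "xs \<in> words V t" "pmf (W xs) y > 0" "j < t" for xs j
    proof -
      have "y \<in> e ` Q xs" using that(2) by (simp add: pmfW[OF that(1)] split: if_splits)
      then have "p \<in> Q xs" using p e QP by (metis (no_types, lifting) image_iff inj_onD subsetD)
      then show ?thesis using that(3) by (auto simp: Q_def)
    qed
    have "p j < m" if "j < t" for j using p that by (auto simp: P_def)
    then have "T (p j) \<in> independent_sets V E" if "j < t" for j
      using T that by (simp add: fold_cover_def)
    then show ?thesis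
      using * by (auto simp: independent_or_power_iff) (auto simp: independent_sets_def)
  qed
  then have "valid_mapping V E t (e ` P) W"
    using finP Qne Qfin image_mono[OF QP, of e] by (simp add: valid_mapping_def W_def)
  moreover have "(\<Sum>y\<in>e ` P. MAX xs\<in>words V t. pmf (W xs) y) \<le> (\<Sum>y\<in>e ` P. 1 / real b ^ t)"
    using finite_words[OF finite_vertices] words_nonempty[OF assms(3)]
      pmf_le
    by (intro sum_mono Max.boundedI) auto
  moreover have "card (e ` P) = m ^ t"
    by (simp add: card_image[OF e]) (simp add: P_def card_PiE)
  ultimately show ?thesis by (auto simp: power_divide)
qed

section \<open>Optimal leakage and its rate\<close>

lemma optimal_leakage_eq:
  assumes "V \<noteq> {}" "c > 1" "t > 0"
  shows "optimal_leakage c V E t = real t * log c (fractional_chromatic_number V E)"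
proof (rule antisym)
  let ?q = "fractional_chromatic_number V E"
  let ?F = "{(Y, W). valid_mapping V E t Y W}"
  let ?o = "optimal_leakage c V E t"
  have q: "?q \<ge> 1" by (rule fractional_chromatic_number_ge_1[OF assms(1)])
  \<comment> \<open>Besides one half of the equality, this shows that the infimum in
    \<open>optimal_leakage\<close> is over a set bounded below, as \<open>upper\<close>
    needs.\<close>
  have lower: "real t * log c ?q \<le> maximal_leakage c V t Y W" if "valid_mapping V E t Y W" for Y W
  proof -
    have "?q ^ t > 0" using q by simp
    moreover note valid_mapping_lower_bound[OF assms(1) that]
    ultimately have "log c (?q ^ t) \<le> maximal_leakage c V t Y W"
      unfolding maximal_leakage_eq[OF finite_vertices assms(1)]
      using assms(2) by (subst log_le_cancel_iff) auto
    then show ?thesis using q by (simp add: log_nat_power)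
  qed
  have upper: "?o \<le> real t * log c (real (multi_chromatic_number V E b) / real b)"
    if b: "b \<ge> 1" for b
  proof -
    let ?m = "real (multi_chromatic_number V E b) / real b"
    have m: "?m > 0" using fractional_chromatic_number_le[OF b] q by linarith
    obtain Y W where YW: "valid_mapping V E t Y W"
      "(\<Sum>y\<in>Y. MAX xs\<in>words V t. pmf (W xs) y) \<le> ?m ^ t"
      using multi_chromatic_number_attained valid_mapping_from_fold_cover[OF _ b assms(1)] by metis
    have "?o \<le> maximal_leakage c V t Y W"
      unfolding optimal_leakage_def
      by (rule cINF_lower2[where x = "(Y, W)"])
        (use YW(1) lower in \<open>auto intro!: bdd_belowI2[of _ "real t * log c ?q"]\<close>)
    also have "\<dots> \<le> log c (?m ^ t)"
    proof -
      \<comment> \<open>Monotonicity of the logarithm needs a positive argument; the lower bound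
        provides it.\<close>
      have "0 < ?q ^ t" using q by simp
      then have "0 < (\<Sum>y\<in>Y. MAX xs\<in>words V t. pmf (W xs) y)"
        using valid_mapping_lower_bound[OF assms(1) YW(1)] by linarith
      then show ?thesis
        unfolding maximal_leakage_eq[OF finite_vertices assms(1)]
        using assms(2) YW(2) m by (subst log_le_cancel_iff) auto
    qed
    finally show ?thesis using m by (simp add: log_nat_power)
  qed
  \<comment> \<open>Exponentiating first lets the infimum over \<open>b\<close> be taken directly,
    without moving it through the logarithm.\<close>
  have "c powr (?o / real t) \<le> ?q"
    unfolding fractional_chromatic_number_def
  proof (rule cINF_greatest)
    fix b :: nat assume "b \<in> {1..}"
    then have b: "b \<ge> 1" by simp
    let ?m = "real (multi_chromatic_number V E b) / real b"
    have m: "?m > 0" using fractional_chromatic_number_le[OF b] q by linarith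
    have "?o / real t \<le> log c ?m" using upper[OF b] assms(3) by (simp add: field_simps)
    then show "c powr (?o / real t) \<le> ?m" using assms(2) m by (simp add: le_log_iff)
  qed auto
  then have "?o / real t \<le> log c ?q" using assms(2) q by (simp add: le_log_iff)
  then show "?o \<le> real t * log c ?q" using assms(3) by (simp add: field_simps)
  \<comment> \<open>A 1-fold colouring already yields a valid mapping.\<close>
  have "?F \<noteq> {}"
    using multi_chromatic_number_attained valid_mapping_from_fold_cover[of 1 _ _ t, OF _ _ assms(1)]
    by fastforce
  then show "real t * log c ?q \<le> ?o"
    unfolding optimal_leakage_def by (rule cINF_greatest) (use lower in auto)
qed

end

theorem theorem1:
  fixes V :: "'a set" and E :: "'a set set" and c :: real
  assumes "simple_graph V E" and "V \<noteq> {}" and "c > 1"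
  shows "convergent (\<lambda>t. optimal_leakage c V E t / real t) \<and>
         leakage_rate c V E = log c (fractional_chromatic_number V E)"
proof -
  \<comment> \<open>The quotients are constant from \<open>t = 1\<close> on; at \<open>t = 0\<close>
    the division by zero gives 0 instead.\<close>
  have "\<forall>\<^sub>F t in sequentially.
      optimal_leakage c V E t / real t = log c (fractional_chromatic_number V E)"
    using eventually_gt_at_top[of 0]
    by eventually_elim (simp add: optimal_leakage_eq[OF assms])
  then have "(\<lambda>t. optimal_leakage c V E t / real t) \<longlonglongrightarrow> log c (fractional_chromatic_number V E)"
    by (rule tendsto_eventually)
  then show ?thesis
    by (auto simp: leakage_rate_def convergent_def intro: limI)
qed

end
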